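(* The complete graph $K_k$ of order $k\ge 3$ has an invertible adjacency matrix $\mathscr{A}$, but it is neither positively nor negatively Moore-Penrose invertible (i.e. $K_k$ is neither positively nor negatively pseudo-invertible).
   Context: For a real symmetric matrix $A$, $A^\dagger$ denotes its Moore-Penrose inverse (equal to $A^{-1}$ when $A$ is invertible). $A^\dagger$ is called positively (negatively) signable if there exists a diagonal matrix $D$ with diagonal entries in $\{+1,-1\}$ such that all entries of $DA^\dagger D$ are non-negative (non-positive). A graph with adjacency matrix $A$ is called positively (negatively) pseudo-invertible (also: Moore-Penrose invertible) if $A^\dagger$ is positively (negatively) signable. *)

theory Defs
  imports "Jordan_Normal_Form.Matrix" "Graph_Theory.Kuratowski"
begin

text \<open>The four Penrose conditions for real matrices. Such a matrix always exists and is unique, so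
  the definite description below denotes it. Uniqueness and the agreement with the ordinary inverse
  are proved here.\<close>

definition is_mp_inverse :: "real mat \<Rightarrow> real mat \<Rightarrow> bool" where
  "is_mp_inverse A X \<longleftrightarrow>
     X \<in> carrier_mat (dim_col A) (dim_row A) \<and>
     A * X * A = A \<and> X * A * X = X \<and>
     transpose_mat (A * X) = A * X \<and> transpose_mat (X * A) = X * A"

definition mp_inverse :: "real mat \<Rightarrow> real mat" where
  "mp_inverse A = (THE X. is_mp_inverse A X)"

lemma is_mp_inverse_unique:
  assumes "is_mp_inverse A X" "is_mp_inverse A Y"
  shows "X = Y"
proof -
  define m n where "m = dim_row A" and "n = dim_col A"
  have A: "A \<in> carrier_mat m n" by (simp add: m_def n_def)
  have X: "X \<in> carrier_mat n m" and Y: "Y \<in> carrier_mat n m"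
    using assms by (auto simp: is_mp_inverse_def m_def n_def)
  have x: "A * X * A = A" "X * A * X = X" "transpose_mat (A * X) = A * X"
    "transpose_mat (X * A) = X * A"
    and y: "A * Y * A = A" "Y * A * Y = Y" "transpose_mat (A * Y) = A * Y"
    "transpose_mat (Y * A) = Y * A"
    using assms by (auto simp: is_mp_inverse_def)
  have AX: "A * X \<in> carrier_mat m m" and AY: "A * Y \<in> carrier_mat m m"
    and XA: "X * A \<in> carrier_mat n n" and YA: "Y * A \<in> carrier_mat n n"
    using A X Y by auto
  have 1: "A * X = A * Y"
  proof -
    have "A * X = A * Y * (A * X)"
      using y(1) assoc_mult_mat[OF AY A X] by simp
    then have "A * X = transpose_mat (A * Y * (A * X))" using x(3) by simp
    also have "\<dots> = A * X * (A * Y)"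
      using transpose_mult[OF AY AX] x(3) y(3) by simp
    also have "\<dots> = A * Y"
      using x(1) assoc_mult_mat[OF AX A Y] by simp
    finally show ?thesis .
  qed
  have 2: "X * A = Y * A"
  proof -
    have "X * A = X * A * (Y * A)"
      using y(1) assoc_mult_mat[OF X A YA] assoc_mult_mat[OF A Y A] by simp
    then have "X * A = transpose_mat (X * A * (Y * A))" using x(4) by simp
    also have "\<dots> = Y * A * (X * A)"
      using transpose_mult[OF XA YA] x(4) y(4) by simp
    also have "\<dots> = Y * A"
      using x(1) assoc_mult_mat[OF Y A XA] assoc_mult_mat[OF A X A] by simp
    finally show ?thesis .
  qed
  have "X = X * A * X" using x(2) by simp
  also have "\<dots> = Y * (A * X)" using 2 assoc_mult_mat[OF Y A X] by simp
  also have "\<dots> = Y * A * Y" using 1 assoc_mult_mat[OF Y A Y] by simp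
  finally show ?thesis using y(2) by simp
qed

lemma mp_inverse_eqI: "is_mp_inverse A X \<Longrightarrow> mp_inverse A = X"
  unfolding mp_inverse_def using is_mp_inverse_unique by blast

lemma mp_inverse_eq_inverse:
  assumes A: "A \<in> carrier_mat n n" and B: "B \<in> carrier_mat n n"
    and "A * B = 1\<^sub>m n" "B * A = 1\<^sub>m n"
  shows "mp_inverse A = B"
  using assms by (intro mp_inverse_eqI) (auto simp: is_mp_inverse_def)

definition signature_mat :: "nat \<Rightarrow> real mat \<Rightarrow> bool" where
  "signature_mat n D \<longleftrightarrow>
     D \<in> carrier_mat n n \<and> diagonal_mat D \<and> (\<forall>i<n. D $$ (i, i) \<in> {1, -1})"

definition positively_signable :: "real mat \<Rightarrow> bool" where
  "positively_signable M \<longleftrightarrow>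
     (\<exists>D. signature_mat (dim_row M) D \<and> (\<forall>e\<in>elements_mat (D * M * D). e \<ge> 0))"

definition negatively_signable :: "real mat \<Rightarrow> bool" where
  "negatively_signable M \<longleftrightarrow>
     (\<exists>D. signature_mat (dim_row M) D \<and> (\<forall>e\<in>elements_mat (D * M * D). e \<le> 0))"

definition vertex_enumeration :: "('a, 'b) pre_digraph \<Rightarrow> 'a list \<Rightarrow> bool" where
  "vertex_enumeration G vs \<longleftrightarrow> distinct vs \<and> set vs = verts G"

definition adjacency_matrix :: "('a, 'b) pre_digraph \<Rightarrow> 'a list \<Rightarrow> real mat" where
  "adjacency_matrix G vs =
     mat (length vs) (length vs) (\<lambda>(i, j). if (vs ! i, vs ! j) \<in> arcs_ends G then 1 else 0)"

text \<open>Reordering the vertices conjugates the adjacency matrix, hence also its Moore-Penrose inverse,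
  by a permutation matrix, which does not affect signability. So it does not matter in the next two
  definitions whether one asks for some or for every enumeration of the vertices.\<close>

definition positively_pseudo_invertible :: "('a, 'b) pre_digraph \<Rightarrow> bool" where
  "positively_pseudo_invertible G \<longleftrightarrow>
     (\<exists>vs. vertex_enumeration G vs \<and> positively_signable (mp_inverse (adjacency_matrix G vs)))"

definition negatively_pseudo_invertible :: "('a, 'b) pre_digraph \<Rightarrow> bool" where
  "negatively_pseudo_invertible G \<longleftrightarrow>
     (\<exists>vs. vertex_enumeration G vs \<and> negatively_signable (mp_inverse (adjacency_matrix G vs)))"

end

theory Submission
  imports Defs
begin

text \<open>In any ordering of the vertices, the adjacency matrix of the complete graph is \<open>J - I\<close>, where
  \<open>J\<close> is the all-ones matrix of order \<open>k\<close>. Since \<open>J\<^sup>2 = k J\<close>, its inverse is \<open>J / (k - 1) - I\<close>, and this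
  is also the Moore-Penrose inverse. It has the negative number \<open>(2 - k) / (k - 1)\<close> on the
  diagonal and the positive number \<open>1 / (k - 1)\<close> elsewhere.

  Conjugation by a signature matrix multiplies the entry \<open>(i, j)\<close> by \<open>d\<^sub>i d\<^sub>j\<close>. Hence it
  preserves every product of entries along a closed walk of indices, because each sign occurs in it
  an even number of times. A closed walk of length one is a diagonal entry, so a negative diagonal
  entry excludes positive signability (\<open>positively_signable_imp_diag_nonneg\<close>). A closed walk of length
  three has a product of three entries, so a positive product around a triangle excludes
  negative signability (\<open>negatively_signable_imp_triangle_nonpos\<close>). The inverse above has both a
  negative diagonal entry and, as \<open>k \<ge> 3\<close>, a triangle of positive entries.\<close>

lemma signature_conjugate_entry:
  assumes D: "signature_mat n D" and M: "M \<in> carrier_mat n n" and "i < n" "j < n"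
  shows "(D * M * D) $$ (i, j) = D $$ (i, i) * D $$ (j, j) * M $$ (i, j)"
proof -
  have c: "D \<in> carrier_mat n n" and d: "\<And>i j. i < n \<Longrightarrow> j < n \<Longrightarrow> i \<noteq> j \<Longrightarrow> D $$ (i, j) = 0"
    using D by (auto simp: signature_mat_def diagonal_mat_def)
  have left: "(D * M) $$ (i, l) = D $$ (i, i) * M $$ (i, l)" if "l < n" for l
  proof -
    have "(D * M) $$ (i, l) = (\<Sum>m = 0..<n. D $$ (i, m) * M $$ (m, l))"
      using c M that \<open>i < n\<close> by (simp add: scalar_prod_def)
    also have "\<dots> = (\<Sum>m = 0..<n. if m = i then D $$ (i, i) * M $$ (i, l) else 0)"
      using d \<open>i < n\<close> by (intro sum.cong) auto
    finally show ?thesis using \<open>i < n\<close> by simp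
  qed
  define E where "E = D * M"
  have "E \<in> carrier_mat n n"
    using c M by (simp add: E_def)
  then have "(E * D) $$ (i, j) = (\<Sum>m = 0..<n. E $$ (i, m) * D $$ (m, j))"
    using c \<open>i < n\<close> \<open>j < n\<close> by (simp add: scalar_prod_def)
  also have "\<dots> = (\<Sum>m = 0..<n. if m = j then D $$ (i, i) * M $$ (i, j) * D $$ (j, j) else 0)"
    using d left \<open>j < n\<close> by (intro sum.cong) (auto simp: E_def)
  finally show ?thesis using \<open>j < n\<close> by (simp add: E_def)
qed

lemma signature_conjugate_in_elements:
  assumes "signature_mat n D" "M \<in> carrier_mat n n" "i < n" "j < n"
  shows "D $$ (i, i) * D $$ (j, j) * M $$ (i, j) \<in> elements_mat (D * M * D)"
proof (rule elements_matI[OF _ assms(3,4)])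
  show "D * M * D \<in> carrier_mat n n"
    using assms by (auto simp: signature_mat_def)
qed (rule signature_conjugate_entry[OF assms, symmetric])

text \<open>A diagonal entry is multiplied by the square of one sign, so conjugation leaves it unchanged.\<close>

lemma positively_signable_imp_diag_nonneg:
  assumes "positively_signable M" and M: "M \<in> carrier_mat n n" and "i < n"
  shows "M $$ (i, i) \<ge> 0"
proof -
  obtain D where D: "signature_mat n D" and nonneg: "\<forall>e\<in>elements_mat (D * M * D). e \<ge> 0"
    using assms by (auto simp: positively_signable_def)
  have "D $$ (i, i) * D $$ (i, i) = 1"
    using D \<open>i < n\<close> by (auto simp: signature_mat_def)
  then show ?thesis
    using nonneg signature_conjugate_in_elements[OF D M \<open>i < n\<close> \<open>i < n\<close>] by auto
qed

text \<open>Around a triangle of indices each of the three signs is used twice, so the product of the three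
  entries survives conjugation; and a product of three non-positive numbers is non-positive.\<close>

lemma negatively_signable_imp_triangle_nonpos:
  assumes "negatively_signable M" and M: "M \<in> carrier_mat n n"
    and "i < n" "j < n" "l < n"
  shows "M $$ (i, j) * M $$ (j, l) * M $$ (l, i) \<le> 0"
proof -
  obtain D where D: "signature_mat n D" and nonpos: "\<forall>e\<in>elements_mat (D * M * D). e \<le> 0"
    using assms by (auto simp: negatively_signable_def)
  define d where "d = (\<lambda>m. D $$ (m, m))"
  have sq: "d m * d m = 1" if "m < n" for m
    using D that by (auto simp: signature_mat_def d_def)
  have entry: "d a * d b * M $$ (a, b) \<le> 0" if "a < n" "b < n" for a b
    using nonpos signature_conjugate_in_elements[OF D M that] by (auto simp: d_def)
  have "M $$ (i, j) * M $$ (j, l) * M $$ (l, i)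
      = (d i * d i) * (d j * d j) * (d l * d l) * (M $$ (i, j) * M $$ (j, l) * M $$ (l, i))"
    using assms by (simp add: sq)
  also have "\<dots> = (d i * d j * M $$ (i, j)) * (d j * d l * M $$ (j, l)) * (d l * d i * M $$ (l, i))"
    by (simp only: mult_ac)
  also have "\<dots> \<le> 0"
    using assms by (intro mult_nonneg_nonpos[OF mult_nonpos_nonpos] entry)
  finally show ?thesis .
qed

text \<open>The matrices \<open>(a - b) I + b J\<close>. They form a commutative algebra that contains both the adjacency
  matrix of the complete graph and its inverse.\<close>

definition two_value_mat :: "nat \<Rightarrow> 'a \<Rightarrow> 'a \<Rightarrow> 'a mat" where
  "two_value_mat n a b = mat n n (\<lambda>(i, j). if i = j then a else b)"

lemma two_value_mat_carrier [simp]: "two_value_mat n a b \<in> carrier_mat n n"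
  by (simp add: two_value_mat_def)

lemma two_value_mat_index [simp]:
  "i < n \<Longrightarrow> j < n \<Longrightarrow> two_value_mat n a b $$ (i, j) = (if i = j then a else b)"
  by (simp add: two_value_mat_def)

lemma two_value_mat_one: "two_value_mat n 1 0 = 1\<^sub>m n"
  by (simp add: two_value_mat_def one_mat_def)

text \<open>This is \<open>J\<^sup>2 = n J\<close>, extended bilinearly.\<close>

lemma two_value_mat_mult:
  fixes a b c d :: "'a :: comm_ring_1"
  shows "two_value_mat n a b * two_value_mat n c d
    = two_value_mat n (a * c + (of_nat n - 1) * b * d) (a * d + b * c + (of_nat n - 2) * b * d)"
    (is "?L = ?R")
proof (rule eq_matI)
  fix i j assume "i < dim_row ?R" "j < dim_col ?R"
  then have ij: "i < n" "j < n" by (auto simp: two_value_mat_def)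
  have "?L $$ (i, j)
      = (\<Sum>m = 0..<n. (if i = m then a else b) * (if m = j then c else d))"
    using ij by (simp add: two_value_mat_def scalar_prod_def)
  \<comment> \<open>Each factor is a constant plus a multiple of a Kronecker delta, so the sum splits into the four
    terms of the expansion.\<close>
  also have "\<dots> = (\<Sum>m = 0..<n. b * d + (if m = i then (a - b) * d else 0)
      + (if m = j then b * (c - d) else 0)
      + (if m = i then (if i = j then (a - b) * (c - d) else 0) else 0))"
    by (intro sum.cong) (auto simp: algebra_simps)
  also have "\<dots> = of_nat n * (b * d) + (a - b) * d + b * (c - d)
      + (if i = j then (a - b) * (c - d) else 0)"
    using ij by (simp add: sum.distrib)
  also have "\<dots> = ?R $$ (i, j)"
    using ij by (simp add: algebra_simps)
  finally show "?L $$ (i, j) = ?R $$ (i, j)" .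
qed (auto simp: two_value_mat_def)

lemma adjacency_matrix_complete_digraph:
  assumes "complete_digraph k G" "vertex_enumeration G vs"
  shows "adjacency_matrix G vs = two_value_mat k 0 1"
proof -
  have "length vs = k"
    using assms distinct_card[of vs] by (auto simp: complete_digraph_def vertex_enumeration_def)
  moreover have "(vs ! i, vs ! j) \<in> arcs_ends G \<longleftrightarrow> i \<noteq> j" if "i < length vs" "j < length vs" for i j
    using assms that nth_mem[of i vs] nth_mem[of j vs]
    by (auto simp: complete_digraph_def vertex_enumeration_def nth_eq_iff_index_eq)
  ultimately show ?thesis
    by (auto simp: adjacency_matrix_def two_value_mat_def)
qed

theorem proposition2p4:
  fixes G :: "('a, 'b) pre_digraph" and k :: nat
  assumes "k \<ge> 3" and "complete_digraph k G"
  shows "(\<forall>vs. vertex_enumeration G vs \<longrightarrow> invertible_mat (adjacency_matrix G vs))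
    \<and> \<not> positively_pseudo_invertible G \<and> \<not> negatively_pseudo_invertible G"
proof -
  define A :: "real mat" where "A = two_value_mat k 0 1"
  define B :: "real mat" where
    "B = two_value_mat k ((2 - real k) / (real k - 1)) (1 / (real k - 1))"
  have carrier: "A \<in> carrier_mat k k" "B \<in> carrier_mat k k"
    by (simp_all add: A_def B_def)
  have inv: "A * B = 1\<^sub>m k" "B * A = 1\<^sub>m k"
    using \<open>k \<ge> 3\<close> unfolding A_def B_def two_value_mat_mult two_value_mat_one[symmetric]
    by (simp_all add: divide_simps)
  have adj: "adjacency_matrix G vs = A" if "vertex_enumeration G vs" for vs
    using adjacency_matrix_complete_digraph[OF assms(2) that] by (simp add: A_def)
  have mp: "mp_inverse A = B"
    using mp_inverse_eq_inverse[OF carrier inv] .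
  have "invertible_mat A"
    using carrier inv by (auto simp: invertible_mat_def inverts_mat_def)
  moreover have "\<not> positively_signable B"
  proof
    assume "positively_signable B"
    from positively_signable_imp_diag_nonneg[OF this carrier(2), of 0] show False
      using \<open>k \<ge> 3\<close> by (simp add: B_def divide_simps)
  qed
  moreover have "\<not> negatively_signable B"
  proof
    assume "negatively_signable B"
    from negatively_signable_imp_triangle_nonpos[OF this carrier(2), of 0 1 2]
    have "(1 / (real k - 1)) * (1 / (real k - 1)) * (1 / (real k - 1)) \<le> 0"
      using \<open>k \<ge> 3\<close> by (simp add: B_def)
    moreover have "1 / (real k - 1) > 0"
      using \<open>k \<ge> 3\<close> by simp
    ultimately show False
      by (meson mult_pos_pos not_le)
  qed
  ultimately show ?thesis
    using adj mp by (auto simp: positively_pseudo_invertible_def negatively_pseudo_invertible_def)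
qed

end
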